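(* Let $D\ge 1$ and $N\ge 2$ be integers and let $x$ be a vertex of the Hamming graph $H(D,N)$. Let $Q=Q(x)$ be the quantum adjacency algebra and $T=T(x)$ the subconstituent algebra of $H(D,N)$ with respect to $x$. Then $Q=T$.
   Context: The Hamming graph $H(D,N)$ has as vertices the $D$-tuples of elements of $\{1,\dots,N\}$; two vertices are adjacent whenever they differ in precisely one coordinate. For a finite, undirected, connected graph (no loops or multiple edges) with vertex set $X$, $\mathrm{Mat}_X(\mathbb{C})$ is the $\mathbb{C}$-algebra of matrices with rows and columns indexed by $X$. Subalgebras contain the identity $I$. Let $\partial$ be the path-length distance, $A\in\mathrm{Mat}_X(\mathbb{C})$ the adjacency matrix, $x\in X$ a fixed vertex, and $e=\max\{\partial(x,y): y\in X\}$. For $0\le i\le e$, $E_i^*$ is the diagonal matrix with $(y,y)$-entry $1$ if $\partial(x,y)=i$ and $0$ otherwise. The subconstituent algebra $T=T(x)$ is the subalgebra of $\mathrm{Mat}_X(\mathbb{C})$ generated by $A$ and $E_0^*,\dots,E_e^*$. Put $L=\sum_{i=1}^{e}E_{i-1}^*AE_i^*$, $F=\sum_{i=0}^{e}E_i^*AE_i^*$, $R=\sum_{i=0}^{e-1}E_{i+1}^*AE_i^*$. The quantum adjacency algebra $Q=Q(x)$ is the subalgebra of $T$ generated by $L,F,R$. *)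

theory Defs
  imports "HOL-Analysis.Analysis"
begin

section \<open>Subalgebras of the full matrix algebra\<close>

text \<open>
  The algebra of matrices indexed by a finite type \<open>'v\<close> is the library type
  \<^typ>\<open>complex ^ 'v ^ 'v\<close> with the product \<open>**\<close>, the identity \<open>mat 1\<close> and the
  entrywise scalar action \<open>map_matrix ((*) c)\<close> (\<open>*\<^sub>R\<close> only has real scalars).
\<close>

definition subalgebra :: "(complex ^ 'v::finite ^ 'v) set \<Rightarrow> bool" where
  "subalgebra S \<longleftrightarrow>
     mat 1 \<in> S \<and>
     (\<forall>M\<in>S. \<forall>M'\<in>S. M + M' \<in> S) \<and>
     (\<forall>M\<in>S. \<forall>M'\<in>S. M ** M' \<in> S) \<and>
     (\<forall>c. \<forall>M\<in>S. map_matrix ((*) c) M \<in> S)"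

definition generated_subalgebra ::
  "(complex ^ 'v::finite ^ 'v) set \<Rightarrow> (complex ^ 'v ^ 'v) set" where
  "generated_subalgebra G = subalgebra hull G"

section \<open>Algebras attached to a vertex of a graph\<close>

text \<open>
  A graph with vertex set \<^term>\<open>UNIV :: 'v set\<close>, \<open>'v\<close> finite, is given by its adjacency
  relation. The definitions below are meant for symmetric, irreflexive relations with
  all vertices connected, see \<open>connected_graph\<close>.
\<close>

definition connected_graph :: "('v::finite \<Rightarrow> 'v \<Rightarrow> bool) \<Rightarrow> bool" where
  "connected_graph E \<longleftrightarrow> symp E \<and> irreflp E \<and> (\<forall>u v. E\<^sup>*\<^sup>* u v)"

text \<open>\<^term>\<open>(E ^^ n) u v\<close> says that there is a walk of length \<open>n\<close> from \<open>u\<close> to \<open>v\<close>.\<close>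

definition graph_dist :: "('v \<Rightarrow> 'v \<Rightarrow> bool) \<Rightarrow> 'v \<Rightarrow> 'v \<Rightarrow> nat" where
  "graph_dist E u v = (LEAST n. (E ^^ n) u v)"

definition eccentricity :: "('v::finite \<Rightarrow> 'v \<Rightarrow> bool) \<Rightarrow> 'v \<Rightarrow> nat" where
  "eccentricity E x = Max {graph_dist E x y | y. y \<in> UNIV}"

definition adjacency_matrix :: "('v::finite \<Rightarrow> 'v \<Rightarrow> bool) \<Rightarrow> complex ^ 'v ^ 'v" where
  "adjacency_matrix E = (\<chi> y z. if E y z then 1 else 0)"

definition dual_idempotent ::
  "('v::finite \<Rightarrow> 'v \<Rightarrow> bool) \<Rightarrow> 'v \<Rightarrow> nat \<Rightarrow> complex ^ 'v ^ 'v" where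
  "dual_idempotent E x i = (\<chi> y z. if y = z \<and> graph_dist E x y = i then 1 else 0)"

definition subconstituent_algebra ::
  "('v::finite \<Rightarrow> 'v \<Rightarrow> bool) \<Rightarrow> 'v \<Rightarrow> (complex ^ 'v ^ 'v) set" where
  "subconstituent_algebra E x =
     generated_subalgebra
       (insert (adjacency_matrix E) {dual_idempotent E x i | i. i \<le> eccentricity E x})"

definition lowering_matrix :: "('v::finite \<Rightarrow> 'v \<Rightarrow> bool) \<Rightarrow> 'v \<Rightarrow> complex ^ 'v ^ 'v" where
  "lowering_matrix E x =
     (\<Sum>i = 1..eccentricity E x.
        dual_idempotent E x (i - 1) ** adjacency_matrix E ** dual_idempotent E x i)"

definition flat_matrix :: "('v::finite \<Rightarrow> 'v \<Rightarrow> bool) \<Rightarrow> 'v \<Rightarrow> complex ^ 'v ^ 'v" where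
  "flat_matrix E x =
     (\<Sum>i = 0..eccentricity E x.
        dual_idempotent E x i ** adjacency_matrix E ** dual_idempotent E x i)"

definition raising_matrix :: "('v::finite \<Rightarrow> 'v \<Rightarrow> bool) \<Rightarrow> 'v \<Rightarrow> complex ^ 'v ^ 'v" where
  "raising_matrix E x =
     (\<Sum>i = 0..<eccentricity E x.
        dual_idempotent E x (i + 1) ** adjacency_matrix E ** dual_idempotent E x i)"

text \<open>
  The three generators lie in the subconstituent algebra, so generating inside it or inside
  the full matrix algebra gives the same result; see \<open>quantum_subset_subconstituent\<close>.
\<close>

definition quantum_adjacency_algebra ::
  "('v::finite \<Rightarrow> 'v \<Rightarrow> bool) \<Rightarrow> 'v \<Rightarrow> (complex ^ 'v ^ 'v) set" where
  "quantum_adjacency_algebra E x =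
     generated_subalgebra {lowering_matrix E x, flat_matrix E x, raising_matrix E x}"

lemma subalgebra_generated: "subalgebra (generated_subalgebra G)"
  unfolding generated_subalgebra_def
  by (rule hull_in) (auto simp: subalgebra_def)

lemma subalgebra_sum:
  assumes S: "subalgebra (S :: (complex ^ 'v::finite ^ 'v) set)" and f: "\<And>i. i \<in> I \<Longrightarrow> f i \<in> S"
  shows "sum f I \<in> S"
proof -
  have "map_matrix ((*) 0) (mat 1) \<in> S"
    using S unfolding subalgebra_def by blast
  moreover have "map_matrix ((*) 0) (mat 1) = (0 :: complex ^ 'v ^ 'v)"
    by (simp add: vec_eq_iff)
  ultimately have "0 \<in> S"
    by simp
  then show ?thesis
    using f
  proof (induction I rule: infinite_finite_induct)
    case (insert i I)
    then show ?case
      using S unfolding subalgebra_def by simp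
  qed simp_all
qed

lemma quantum_subset_subconstituent:
  "quantum_adjacency_algebra E x \<subseteq> subconstituent_algebra E x"
proof -
  let ?T = "subconstituent_algebra E x"
  have T: "subalgebra ?T"
    unfolding subconstituent_algebra_def by (rule subalgebra_generated)
  have gens: "insert (adjacency_matrix E)
      {dual_idempotent E x i | i. i \<le> eccentricity E x} \<subseteq> ?T"
    unfolding subconstituent_algebra_def generated_subalgebra_def by (rule hull_subset)
  have block: "dual_idempotent E x i ** adjacency_matrix E ** dual_idempotent E x j \<in> ?T"
    if "i \<le> eccentricity E x" "j \<le> eccentricity E x" for i j
  proof -
    have "dual_idempotent E x i \<in> ?T" "dual_idempotent E x j \<in> ?T" "adjacency_matrix E \<in> ?T"
      using gens that by blast+
    then show ?thesis
      using T unfolding subalgebra_def by blast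
  qed
  have "lowering_matrix E x \<in> ?T" "flat_matrix E x \<in> ?T" "raising_matrix E x \<in> ?T"
    unfolding lowering_matrix_def flat_matrix_def raising_matrix_def
    by (rule subalgebra_sum[OF T], rule block; auto)+
  then show ?thesis
    unfolding quantum_adjacency_algebra_def generated_subalgebra_def
    by (intro hull_minimal) (use T in auto)
qed

section \<open>The Hamming graph\<close>

text \<open>
  Vertices are the tuples \<^typ>\<open>'n ^ 'd\<close>: there are \<open>D = CARD('d)\<close> coordinates, each ranging
  over an alphabet with \<open>N = CARD('n)\<close> elements.
\<close>

definition hamming_adj :: "'n::finite ^ 'd::finite \<Rightarrow> 'n ^ 'd \<Rightarrow> bool" where
  "hamming_adj u v \<longleftrightarrow> card {i. u $ i \<noteq> v $ i} = 1"

lemma connected_graph_hamming: "connected_graph (hamming_adj :: 'n::finite ^ 'd::finite \<Rightarrow> _)"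
proof -
  have "hamming_adj\<^sup>*\<^sup>* u v" for u v :: "'n ^ 'd"
  proof (induction "card {i. u $ i \<noteq> v $ i}" arbitrary: u)
    case 0
    then have "u = v"
      by (simp add: vec_eq_iff)
    then show ?case by simp
  next
    case (Suc n)
    then obtain j where j: "u $ j \<noteq> v $ j"
      by fastforce
    define w where "w = (\<chi> i. if i = j then v $ j else u $ i)"
    have "{i. u $ i \<noteq> w $ i} = {j}"
      using j by (auto simp: w_def)
    then have "hamming_adj u w"
      by (simp add: hamming_adj_def)
    have "{i. w $ i \<noteq> v $ i} = {i. u $ i \<noteq> v $ i} - {j}"
      by (auto simp: w_def)
    then have "n = card {i. w $ i \<noteq> v $ i}"
      using Suc.hyps(2) j by simp
    then have "hamming_adj\<^sup>*\<^sup>* w v"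
      by (rule Suc.hyps(1))
    with \<open>hamming_adj u w\<close> show ?case
      by (rule converse_rtranclp_into_rtranclp)
  qed
  moreover have "symp (hamming_adj :: 'n ^ 'd \<Rightarrow> _)"
    by (auto simp: symp_def hamming_adj_def eq_commute)
  moreover have "irreflp (hamming_adj :: 'n ^ 'd \<Rightarrow> _)"
    by (auto simp: irreflp_def hamming_adj_def)
  ultimately show ?thesis
    unfolding connected_graph_def by blast
qed

end

theory Submission
  imports Defs
begin

text \<open>
  The quantum adjacency algebra \<open>Q\<close> always lies in the subconstituent algebra \<open>T\<close>, and it contains
  the adjacency matrix, which is \<open>L + F + R\<close> because distances to the base vertex \<open>x\<close> change by at
  most one along an edge. What remains is to find the dual idempotents inside \<open>Q\<close>. They are the
  spectral projections of the diagonal matrix \<open>H\<close> whose \<open>y\<close>-entry is the distance from \<open>x\<close> to \<open>y\<close>,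
  hence polynomials in \<open>H\<close> (Lagrange interpolation, \<open>indicator_diag_in_subalgebra\<close>), so
  it suffices that \<open>H \<in> Q\<close>.

  This follows from a commutator identity special to the Hamming graph, with \<open>D\<close> coordinates and
  an alphabet of \<open>N\<close> letters:
  \<open>L R - R L + F = (N D - D) I - N H\<close> (\<open>hamming_commutator\<close>), which can be solved for \<open>H\<close>.
  To see it, note that each of \<open>L\<close>, \<open>F\<close>, \<open>R\<close> is a sum of operators that act on a single
  coordinate; in tensor language, \<open>L = \<Sum>\<^sub>i 1 \<otimes> \<dots> \<otimes> l\<^sub>i \<otimes> \<dots> \<otimes> 1\<close>, where \<open>l\<^sub>i\<close> sends every letter
  other than the letter of \<open>x\<close> to the letter of \<open>x\<close>. Operators on different coordinates commute, so
  the identity reduces to one on a single complete graph, \<open>l r - r l + f = N e - I\<close> with \<open>e\<close> the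
  projection onto the letter of \<open>x\<close>; summing over the coordinates turns \<open>e\<close> into \<open>D - H\<close>.
\<close>

section \<open>Diagonal matrices in a matrix algebra\<close>

definition diag_mat :: "('v::finite \<Rightarrow> complex) \<Rightarrow> complex ^ 'v ^ 'v" where
  "diag_mat h = (\<chi> y z. if y = z then h y else 0)"

lemma diag_mat_const: "diag_mat (\<lambda>_. c) = map_matrix ((*) c) (mat 1)"
  by (simp add: diag_mat_def mat_def vec_eq_iff)

lemma diag_mat_add: "diag_mat g + diag_mat h = diag_mat (\<lambda>y. g y + h y)"
  by (simp add: diag_mat_def vec_eq_iff)

lemma diag_mat_sum: "(\<Sum>i\<in>I. diag_mat (g i)) = diag_mat (\<lambda>y. \<Sum>i\<in>I. g i y)"
  by (auto simp: diag_mat_def vec_eq_iff intro!: sum.neutral)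

lemma diag_mat_scale: "map_matrix ((*) c) (diag_mat h) = diag_mat (\<lambda>y. c * h y)"
  by (simp add: diag_mat_def vec_eq_iff)

lemma diag_mat_mult_nth: "(diag_mat g ** M) $ y $ z = g y * M $ y $ z"
proof -
  have "(diag_mat g ** M) $ y $ z = (\<Sum>k\<in>UNIV. if k = y then g y * M $ k $ z else 0)"
    unfolding matrix_matrix_mult_def diag_mat_def vec_lambda_beta
    by (rule sum.cong) auto
  then show ?thesis by simp
qed

lemma mult_diag_mat_nth: "(M ** diag_mat g) $ y $ z = M $ y $ z * g z"
proof -
  have "(M ** diag_mat g) $ y $ z = (\<Sum>k\<in>UNIV. if k = z then M $ y $ k * g z else 0)"
    unfolding matrix_matrix_mult_def diag_mat_def vec_lambda_beta
    by (rule sum.cong) auto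
  then show ?thesis by simp
qed

lemma diag_mat_mult: "diag_mat g ** diag_mat h = diag_mat (\<lambda>y. g y * h y)"
  by (auto simp: vec_eq_iff diag_mat_mult_nth) (auto simp: diag_mat_def)

lemma subalgebraD:
  assumes "subalgebra S"
  shows "mat 1 \<in> S"
    and "M \<in> S \<Longrightarrow> M' \<in> S \<Longrightarrow> M + M' \<in> S"
    and "M \<in> S \<Longrightarrow> M' \<in> S \<Longrightarrow> M ** M' \<in> S"
    and "M \<in> S \<Longrightarrow> map_matrix ((*) c) M \<in> S"
  using assms unfolding subalgebra_def by blast+

lemma subalgebra_diff:
  assumes S: "subalgebra S" and "M \<in> S" "M' \<in> S"
  shows "M - M' \<in> S"
proof -
  have "M + map_matrix ((*) (-1)) M' \<in> S"
    using assms by (intro subalgebraD)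
  also have "M + map_matrix ((*) (-1)) M' = M - M'"
    by (simp add: vec_eq_iff)
  finally show ?thesis .
qed

lemma diag_const_in_subalgebra: "subalgebra S \<Longrightarrow> diag_mat (\<lambda>_. c) \<in> S"
  by (simp add: diag_mat_const subalgebraD)

lemma diag_prod_in_subalgebra:
  assumes S: "subalgebra S" and "finite J" and "\<And>j. j \<in> J \<Longrightarrow> diag_mat (g j) \<in> S"
  shows "diag_mat (\<lambda>y. \<Prod>j\<in>J. g j y) \<in> S"
  using assms(2,3)
proof (induction J)
  case empty
  then show ?case using S by (simp add: diag_const_in_subalgebra)
next
  case (insert j J)
  then have "diag_mat (g j) ** diag_mat (\<lambda>y. \<Prod>j\<in>J. g j y) \<in> S"
    using S by (intro subalgebraD(3)) auto
  with insert show ?case by (simp add: diag_mat_mult)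
qed

text \<open>
  The projection onto the eigenspace for \<open>v\<close> is the value at the given diagonal matrix of the
  Lagrange polynomial that is \<open>1\<close> at \<open>v\<close> and \<open>0\<close> at all other eigenvalues.
\<close>

lemma indicator_diag_in_subalgebra:
  assumes S: "subalgebra S" and h: "diag_mat h \<in> S"
  shows "diag_mat (\<lambda>y. if h y = v then 1 else 0) \<in> S"
proof -
  let ?J = "range h - {v}"
  have factor: "diag_mat (\<lambda>y. (h y - c) / (v - c)) \<in> S" for c
  proof -
    have "diag_mat (\<lambda>y. 1 / (v - c) * (h y + - c)) \<in> S"
      unfolding diag_mat_scale[symmetric] diag_mat_add[symmetric]
      using S h by (intro subalgebraD diag_const_in_subalgebra)
    then show ?thesis by simp
  qed
  have "diag_mat (\<lambda>y. \<Prod>c\<in>?J. (h y - c) / (v - c)) \<in> S"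
    by (rule diag_prod_in_subalgebra[OF S _ factor]) simp
  moreover have "(\<Prod>c\<in>?J. (h y - c) / (v - c)) = (if h y = v then 1 else 0)" for y
    by (auto intro!: prod.neutral)
  ultimately show ?thesis by simp
qed

section \<open>Lowering, flat and raising matrices of a graph\<close>

lemma graph_dist_le_eccentricity: "graph_dist E x y \<le> eccentricity E x"
  unfolding eccentricity_def by (rule Max_ge) (auto simp: full_SetCompr_eq)

lemma dual_idempotent_diag:
  "dual_idempotent E x i = diag_mat (\<lambda>y. if graph_dist E x y = i then 1 else 0)"
  by (simp add: dual_idempotent_def diag_mat_def vec_eq_iff)

lemma dual_block_nth:
  "(dual_idempotent E x i ** adjacency_matrix E ** dual_idempotent E x j) $ y $ z =
     (if j = graph_dist E x z then if E y z \<and> graph_dist E x y = i then 1 else 0 else 0)"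
  by (simp add: dual_idempotent_diag mult_diag_mat_nth diag_mat_mult_nth adjacency_matrix_def)

lemma lowering_matrix_nth:
  "lowering_matrix E x $ y $ z =
     (if E y z \<and> graph_dist E x z = graph_dist E x y + 1 then 1 else 0)"
  using graph_dist_le_eccentricity[of E x z]
  by (auto simp: lowering_matrix_def dual_block_nth sum.delta')

lemma flat_matrix_nth:
  "flat_matrix E x $ y $ z = (if E y z \<and> graph_dist E x z = graph_dist E x y then 1 else 0)"
  using graph_dist_le_eccentricity[of E x z]
  by (auto simp: flat_matrix_def dual_block_nth sum.delta')

lemma raising_matrix_nth:
  "raising_matrix E x $ y $ z =
     (if E y z \<and> graph_dist E x y = graph_dist E x z + 1 then 1 else 0)"
  using graph_dist_le_eccentricity[of E x y]
  by (auto simp: raising_matrix_def dual_block_nth sum.delta')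

section \<open>Distance in the Hamming graph\<close>

lemma hamming_adj_iff:
  "hamming_adj u v \<longleftrightarrow> (\<exists>i. u $ i \<noteq> v $ i \<and> (\<forall>k. k \<noteq> i \<longrightarrow> u $ k = v $ k))"
  unfolding hamming_adj_def One_nat_def card_1_singleton_iff by (auto simp: set_eq_iff)

lemma hamming_walk_length_ge:
  "(hamming_adj ^^ n) u v \<Longrightarrow> card {i. u $ i \<noteq> v $ i} \<le> n"
proof (induction n arbitrary: v)
  case (Suc n)
  then obtain w where w: "(hamming_adj ^^ n) u w" "hamming_adj w v" by auto
  have "card {i. u $ i \<noteq> v $ i} \<le> card ({i. u $ i \<noteq> w $ i} \<union> {i. w $ i \<noteq> v $ i})"
    by (rule card_mono) auto
  also have "\<dots> \<le> card {i. u $ i \<noteq> w $ i} + card {i. w $ i \<noteq> v $ i}"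
    by (rule card_Un_le)
  finally show ?case
    using Suc.IH[OF w(1)] w(2) by (simp add: hamming_adj_def)
qed simp

lemma hamming_walk_exists:
  "(hamming_adj ^^ card {i. u $ i \<noteq> v $ i}) u v"
proof (induction "card {i. u $ i \<noteq> v $ i}" arbitrary: v)
  case 0
  then show ?case by (simp add: vec_eq_iff)
next
  case (Suc n)
  then obtain j where j: "u $ j \<noteq> v $ j"
    by fastforce
  define w where "w = (\<chi> i. if i = j then u $ j else v $ i)"
  have "hamming_adj w v"
    using j by (auto simp: hamming_adj_iff w_def)
  have "{i. u $ i \<noteq> w $ i} = {i. u $ i \<noteq> v $ i} - {j}"
    by (auto simp: w_def)
  then have "n = card {i. u $ i \<noteq> w $ i}"
    using Suc.hyps(2) j by simp
  with Suc.hyps(1)[OF this] \<open>hamming_adj w v\<close> show ?case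
    by (auto simp flip: Suc.hyps(2))
qed

lemma graph_dist_hamming: "graph_dist hamming_adj u v = card {i. u $ i \<noteq> v $ i}"
  unfolding graph_dist_def
  by (rule Least_equality) (auto intro: hamming_walk_exists hamming_walk_length_ge)

lemma graph_dist_hamming_sum:
  "graph_dist hamming_adj u v = (\<Sum>i\<in>UNIV. if v $ i = u $ i then 0 else 1)"
proof -
  have "graph_dist hamming_adj u v = (\<Sum>i\<in>{i. u $ i \<noteq> v $ i}. 1)"
    by (simp add: graph_dist_hamming)
  also have "\<dots> = (\<Sum>i\<in>UNIV. if v $ i = u $ i then 0 else 1)"
    by (rule sum.mono_neutral_cong_left) auto
  finally show ?thesis .
qed

text \<open>
  Only the coordinate at which two vertices differ matters for comparing their distances to \<open>x\<close>.
  The contribution of that coordinate to the other distance is added on each side, rather than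
  subtracted from its own, to stay within the natural numbers.
\<close>

lemma graph_dist_hamming_change:
  assumes "\<forall>k. k \<noteq> i \<longrightarrow> y $ k = z $ k"
  shows "graph_dist hamming_adj x y + (if z $ i = x $ i then 0 else 1) =
         graph_dist hamming_adj x z + (if y $ i = x $ i then 0 else 1)"
proof -
  have "graph_dist hamming_adj x w = (if w $ i = x $ i then 0 else 1) +
          (\<Sum>k\<in>UNIV - {i}. if w $ k = x $ k then 0 else 1)" for w
    unfolding graph_dist_hamming_sum by (rule sum.remove) auto
  moreover have "(\<Sum>k\<in>UNIV - {i}. if y $ k = x $ k then 0 else 1) =
      (\<Sum>k\<in>UNIV - {i}. if z $ k = x $ k then 0 else (1::nat))"
    using assms by (intro sum.cong) auto
  ultimately show ?thesis by simp
qed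

section \<open>Operators acting on one coordinate\<close>

text \<open>
  The tensor product with the matrix \<open>m\<close> in factor \<open>i\<close> and the identity in all other factors. The
  small matrix is a curried function, so that entries can be written as plain lambda terms.
\<close>

definition coord_op ::
  "'d::finite \<Rightarrow> ('n::finite \<Rightarrow> 'n \<Rightarrow> complex) \<Rightarrow> complex ^ ('n ^ 'd) ^ ('n ^ 'd)" where
  "coord_op i m = (\<chi> y z. if \<forall>k. k \<noteq> i \<longrightarrow> y $ k = z $ k then m (y $ i) (z $ i) else 0)"

definition vec_upd :: "'n ^ 'd::finite \<Rightarrow> 'd \<Rightarrow> 'n \<Rightarrow> 'n ^ 'd" where
  "vec_upd y i c = (\<chi> k. if k = i then c else y $ k)"

lemma vec_upd_nth [simp]: "vec_upd y i c $ k = (if k = i then c else y $ k)"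
  by (simp add: vec_upd_def)

lemma vec_upd_eq_self: "\<forall>k. k \<noteq> i \<longrightarrow> y $ k = w $ k \<Longrightarrow> vec_upd y i (w $ i) = w"
  by (simp add: vec_eq_iff)

lemma coord_op_mult_nth:
  "(coord_op i m ** M) $ y $ z = (\<Sum>c\<in>UNIV. m (y $ i) c * M $ vec_upd y i c $ z)"
proof -
  let ?W = "{w. \<forall>k. k \<noteq> i \<longrightarrow> y $ k = w $ k}"
  have "(coord_op i m ** M) $ y $ z = (\<Sum>w\<in>?W. m (y $ i) (w $ i) * M $ w $ z)"
    unfolding matrix_matrix_mult_def coord_op_def
    by (simp add: if_distrib[of "\<lambda>t. t * _"] sum.If_cases)
  also have "\<dots> = (\<Sum>c\<in>UNIV. m (y $ i) c * M $ vec_upd y i c $ z)"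
    by (rule sum.reindex_bij_witness[of _ "vec_upd y i" "\<lambda>w. w $ i"])
      (auto simp: vec_upd_eq_self)
  finally show ?thesis .
qed

lemma coord_op_mult_same:
  "coord_op i a ** coord_op i b = coord_op i (\<lambda>p q. \<Sum>c\<in>UNIV. a p c * b c q)"
  by (auto simp: vec_eq_iff coord_op_mult_nth) (auto simp: coord_op_def intro!: sum.neutral)

lemma coord_op_mult_other_nth:
  assumes "i \<noteq> j"
  shows "(coord_op i a ** coord_op j b) $ y $ z =
    (if \<forall>k. k \<noteq> i \<and> k \<noteq> j \<longrightarrow> y $ k = z $ k then a (y $ i) (z $ i) * b (y $ j) (z $ j) else 0)"
    (is "_ = ?rhs")
proof -
  have "(coord_op i a ** coord_op j b) $ y $ z = (\<Sum>c\<in>UNIV. if c = z $ i then ?rhs else 0)"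
    unfolding coord_op_mult_nth
    using assms by (intro sum.cong) (auto simp: coord_op_def)
  then show ?thesis by simp
qed

lemma coord_op_commute:
  assumes "i \<noteq> j"
  shows "coord_op i a ** coord_op j b = coord_op j b ** coord_op i a"
  using assms by (auto simp: vec_eq_iff coord_op_mult_other_nth)

lemma coord_op_add: "coord_op i a + coord_op i b = coord_op i (\<lambda>p q. a p q + b p q)"
  unfolding coord_op_def vec_eq_iff by auto

lemma coord_op_diff: "coord_op i a - coord_op i b = coord_op i (\<lambda>p q. a p q - b p q)"
  unfolding coord_op_def vec_eq_iff by auto

lemma coord_op_diag: "coord_op i (\<lambda>p q. if p = q then g p else 0) = diag_mat (\<lambda>y. g (y $ i))"
  unfolding coord_op_def diag_mat_def vec_eq_iff by (simp, metis)

lemma matrix_mult_sum_left: "(\<Sum>i\<in>I. f i) ** (M :: complex ^ 'v ^ 'v) = (\<Sum>i\<in>I. f i ** M)"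
  by (simp add: vec_eq_iff matrix_matrix_mult_def sum_distrib_right sum.swap[of _ I])

lemma matrix_mult_sum_right: "(M :: complex ^ 'v ^ 'v) ** (\<Sum>i\<in>I. f i) = (\<Sum>i\<in>I. M ** f i)"
  by (simp add: vec_eq_iff matrix_matrix_mult_def sum_distrib_left sum.swap[of _ I])

text \<open>Since operators on different coordinates commute, only the diagonal terms survive.\<close>

lemma coord_op_sum_commutator:
  "(\<Sum>i\<in>UNIV. coord_op i (a i)) ** (\<Sum>i\<in>UNIV. coord_op i (b i))
     - (\<Sum>i\<in>UNIV. coord_op i (b i)) ** (\<Sum>i\<in>UNIV. coord_op i (a i)) =
   (\<Sum>i\<in>UNIV. coord_op i (a i) ** coord_op i (b i) - coord_op i (b i) ** coord_op i (a i))"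
  (is "?A ** ?B - ?B ** ?A = _")
proof -
  let ?C = "\<lambda>i j. coord_op i (a i) ** coord_op j (b j) - coord_op j (b j) ** coord_op i (a i)"
  have "?B ** ?A = (\<Sum>i\<in>UNIV. \<Sum>j\<in>UNIV. coord_op j (b j) ** coord_op i (a i))"
    unfolding matrix_mult_sum_left matrix_mult_sum_right by (rule refl)
  moreover have "?A ** ?B = (\<Sum>i\<in>UNIV. \<Sum>j\<in>UNIV. coord_op i (a i) ** coord_op j (b j))"
    unfolding matrix_mult_sum_left by (simp only: matrix_mult_sum_right)
  ultimately have "?A ** ?B - ?B ** ?A = (\<Sum>i\<in>UNIV. \<Sum>j\<in>UNIV. ?C i j)"
    by (simp only: sum_subtractf)
  also have "\<dots> = (\<Sum>i\<in>UNIV. \<Sum>j\<in>UNIV. if j = i then ?C i i else 0)"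
    by (intro sum.cong refl) (auto simp: coord_op_commute)
  finally show ?thesis by simp
qed

text \<open>
  An operator with zero diagonal in every coordinate is supported on the edges of the Hamming
  graph, and on an edge only the coordinate in which the two ends differ contributes.
\<close>

lemma sum_coord_op_nth:
  assumes "\<And>i p. m i p p = 0" and "y $ i \<noteq> z $ i" and "\<forall>k. k \<noteq> i \<longrightarrow> y $ k = z $ k"
  shows "(\<Sum>i\<in>UNIV. coord_op i (m i)) $ y $ z = m i (y $ i) (z $ i)"
proof -
  have "(\<Sum>i\<in>UNIV. coord_op i (m i)) $ y $ z =
      (\<Sum>j\<in>UNIV. if j = i then m i (y $ i) (z $ i) else 0)"
    unfolding sum_component
    using assms by (intro sum.cong) (auto simp: coord_op_def)
  then show ?thesis by simp
qed

lemma sum_coord_op_nth_nonadj: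
  assumes "\<And>i p. m i p p = 0" and "\<not> hamming_adj y z"
  shows "(\<Sum>i\<in>UNIV. coord_op i (m i)) $ y $ z = 0"
  unfolding sum_component
  using assms unfolding hamming_adj_iff coord_op_def vec_lambda_beta
  by (intro sum.neutral ballI) metis

section \<open>The commutator identity in the Hamming graph\<close>

lemma lowering_hamming:
  "lowering_matrix hamming_adj x =
     (\<Sum>i\<in>UNIV. coord_op i (\<lambda>p q. if p = x $ i \<and> q \<noteq> x $ i then 1 else 0))"
  (is "_ = (\<Sum>i\<in>UNIV. coord_op i (?m i))")
proof -
  have "lowering_matrix hamming_adj x $ y $ z = (\<Sum>i\<in>UNIV. coord_op i (?m i)) $ y $ z" for y z
  proof (cases "hamming_adj y z")
    case True
    then obtain i where "y $ i \<noteq> z $ i" and i: "\<forall>k. k \<noteq> i \<longrightarrow> y $ k = z $ k"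
      by (auto simp: hamming_adj_iff)
    then show ?thesis
      using True graph_dist_hamming_change[OF i, of x]
      by (subst sum_coord_op_nth[of ?m]) (auto simp: lowering_matrix_nth split: if_splits)
  next
    case False
    then show ?thesis
      by (subst sum_coord_op_nth_nonadj) (auto simp: lowering_matrix_nth)
  qed
  then show ?thesis by (simp add: vec_eq_iff del: sum_component)
qed

lemma raising_hamming:
  "raising_matrix hamming_adj x =
     (\<Sum>i\<in>UNIV. coord_op i (\<lambda>p q. if p \<noteq> x $ i \<and> q = x $ i then 1 else 0))"
  (is "_ = (\<Sum>i\<in>UNIV. coord_op i (?m i))")
proof -
  have "raising_matrix hamming_adj x $ y $ z = (\<Sum>i\<in>UNIV. coord_op i (?m i)) $ y $ z" for y z
  proof (cases "hamming_adj y z")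
    case True
    then obtain i where "y $ i \<noteq> z $ i" and i: "\<forall>k. k \<noteq> i \<longrightarrow> y $ k = z $ k"
      by (auto simp: hamming_adj_iff)
    then show ?thesis
      using True graph_dist_hamming_change[OF i, of x]
      by (subst sum_coord_op_nth[of ?m]) (auto simp: raising_matrix_nth split: if_splits)
  next
    case False
    then show ?thesis
      by (subst sum_coord_op_nth_nonadj) (auto simp: raising_matrix_nth)
  qed
  then show ?thesis by (simp add: vec_eq_iff del: sum_component)
qed

lemma flat_hamming:
  "flat_matrix hamming_adj x =
     (\<Sum>i\<in>UNIV. coord_op i (\<lambda>p q. if p \<noteq> x $ i \<and> q \<noteq> x $ i \<and> p \<noteq> q then 1 else 0))"
  (is "_ = (\<Sum>i\<in>UNIV. coord_op i (?m i))")
proof -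
  have "flat_matrix hamming_adj x $ y $ z = (\<Sum>i\<in>UNIV. coord_op i (?m i)) $ y $ z" for y z
  proof (cases "hamming_adj y z")
    case True
    then obtain i where "y $ i \<noteq> z $ i" and i: "\<forall>k. k \<noteq> i \<longrightarrow> y $ k = z $ k"
      by (auto simp: hamming_adj_iff)
    then show ?thesis
      using True graph_dist_hamming_change[OF i, of x]
      by (subst sum_coord_op_nth[of ?m]) (auto simp: flat_matrix_nth split: if_splits)
  next
    case False
    then show ?thesis
      by (subst sum_coord_op_nth_nonadj) (auto simp: flat_matrix_nth)
  qed
  then show ?thesis by (simp add: vec_eq_iff del: sum_component)
qed

lemma adjacency_hamming:
  "adjacency_matrix hamming_adj =
     lowering_matrix hamming_adj x + flat_matrix hamming_adj x + raising_matrix hamming_adj x"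
proof -
  have "graph_dist hamming_adj x z = graph_dist hamming_adj x y + 1 \<or>
        graph_dist hamming_adj x z = graph_dist hamming_adj x y \<or>
        graph_dist hamming_adj x y = graph_dist hamming_adj x z + 1" if "hamming_adj y z" for y z
  proof -
    obtain i where i: "\<forall>k. k \<noteq> i \<longrightarrow> y $ k = z $ k"
      using \<open>hamming_adj y z\<close> by (auto simp: hamming_adj_iff)
    show ?thesis
      using graph_dist_hamming_change[OF i, of x] by (auto split: if_splits)
  qed
  then show ?thesis
    by (auto simp: vec_eq_iff adjacency_matrix_def lowering_matrix_nth flat_matrix_nth
        raising_matrix_nth)
qed

text \<open>
  The identity on one copy of the complete graph with base letter \<open>u\<close>: \<open>l r\<close> is \<open>N - 1\<close> times the
  projection onto \<open>u\<close>, while \<open>r l\<close> is the all-ones matrix on the other letters, that is, \<open>f\<close> plus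
  the projection onto them.
\<close>

lemma complete_graph_commutator:
  fixes u p q :: "'n::finite"
  defines "l \<equiv> \<lambda>p q. if p = u \<and> q \<noteq> u then 1 else 0"
    and "r \<equiv> \<lambda>p q. if p \<noteq> u \<and> q = u then 1 else 0"
    and "f \<equiv> \<lambda>p q. if p \<noteq> u \<and> q \<noteq> u \<and> p \<noteq> q then 1 else 0"
  shows "(\<Sum>c\<in>UNIV. l p c * r c q) - (\<Sum>c\<in>UNIV. r p c * l c q) + f p q =
     (if p = q then (if p = u then of_nat CARD('n) else 0) - 1 else (0 :: complex))"
proof -
  have "(\<Sum>c\<in>UNIV. l p c * r c q) = (\<Sum>c\<in>UNIV - {u}. if p = u \<and> q = u then 1 else 0)"
    by (rule sum.mono_neutral_cong_right) (auto simp: l_def r_def)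
  then have lr: "(\<Sum>c\<in>UNIV. l p c * r c q) =
      (if p = u \<and> q = u then of_nat CARD('n) - 1 else 0)"
    by (simp add: card_Diff_singleton of_nat_diff Suc_leI)
  have "(\<Sum>c\<in>UNIV. r p c * l c q) =
      (\<Sum>c\<in>UNIV. if c = u then if p \<noteq> u \<and> q \<noteq> u then 1 else 0 else 0)"
    by (rule sum.cong) (auto simp: l_def r_def)
  then have rl: "(\<Sum>c\<in>UNIV. r p c * l c q) = (if p \<noteq> u \<and> q \<noteq> u then 1 else 0)"
    by simp
  show ?thesis
    unfolding lr rl by (auto simp: f_def)
qed

lemma hamming_commutator:
  fixes x :: "'n::finite ^ 'd::finite"
  defines "L \<equiv> lowering_matrix hamming_adj x"
    and "F \<equiv> flat_matrix hamming_adj x"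
    and "R \<equiv> raising_matrix hamming_adj x"
  shows "L ** R - R ** L + F =
     diag_mat (\<lambda>y. of_nat CARD('n) * (of_nat CARD('d) - of_nat (graph_dist hamming_adj x y))
                    - of_nat CARD('d))"
proof -
  let ?g = "\<lambda>i p. (if p = x $ i then of_nat CARD('n) else 0) - 1 :: complex"
  have entry: "(\<Sum>i\<in>UNIV. ?g i (y $ i)) =
      of_nat CARD('n) * (of_nat CARD('d) - of_nat (graph_dist hamming_adj x y))
        - of_nat CARD('d)" for y
  proof -
    have "(\<Sum>i\<in>UNIV. ?g i (y $ i)) =
        (\<Sum>i\<in>UNIV. of_nat CARD('n) * (1 - of_nat (if y $ i = x $ i then 0 else 1)) - 1)"
      by (rule sum.cong) auto
    also have "\<dots> = of_nat CARD('n) *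
        (of_nat CARD('d) - of_nat (graph_dist hamming_adj x y)) - of_nat CARD('d)"
      unfolding graph_dist_hamming_sum of_nat_sum
      by (simp only: sum_subtractf sum_distrib_left[symmetric]) simp
    finally show ?thesis .
  qed
  have "L ** R - R ** L + F =
      (\<Sum>i\<in>UNIV. coord_op i (\<lambda>p q. if p = q then ?g i p else 0))"
    unfolding L_def R_def F_def lowering_hamming raising_hamming flat_hamming
      coord_op_sum_commutator
    unfolding sum.distrib[symmetric] coord_op_mult_same coord_op_diff coord_op_add
      complete_graph_commutator by (rule refl)
  also have "\<dots> = diag_mat (\<lambda>y. \<Sum>i\<in>UNIV. ?g i (y $ i))"
    unfolding coord_op_diag diag_mat_sum by (rule refl)
  finally show ?thesis
    unfolding entry .
qed

section \<open>Equality of the two algebras\<close>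

theorem proposition11p1:
  fixes x :: "'n::finite ^ 'd::finite"
  assumes "CARD('d) \<ge> 1" and "CARD('n) \<ge> 2"
  shows "quantum_adjacency_algebra hamming_adj x = subconstituent_algebra hamming_adj x"
proof
  let ?Q = "quantum_adjacency_algebra hamming_adj x"
  let ?L = "lowering_matrix hamming_adj x"
  let ?F = "flat_matrix hamming_adj x"
  let ?R = "raising_matrix hamming_adj x"
  let ?dist = "graph_dist hamming_adj x"
  let ?N = "of_nat CARD('n) :: complex"
  let ?D = "of_nat CARD('d) :: complex"
  show "?Q \<subseteq> subconstituent_algebra hamming_adj x"
    by (rule quantum_subset_subconstituent)
  have Q: "subalgebra ?Q"
    unfolding quantum_adjacency_algebra_def by (rule subalgebra_generated)
  have "{?L, ?F, ?R} \<subseteq> ?Q"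
    unfolding quantum_adjacency_algebra_def generated_subalgebra_def by (rule hull_subset)
  then have gens: "?L \<in> ?Q" "?F \<in> ?Q" "?R \<in> ?Q"
    by auto
  then have "?L ** ?R - ?R ** ?L + ?F \<in> ?Q"
    using Q by (intro subalgebraD subalgebra_diff)
  then have h: "diag_mat (\<lambda>y. ?N * (?D - of_nat (?dist y)) - ?D) \<in> ?Q"
    unfolding hamming_commutator .
  \<comment> \<open>This diagonal matrix has as many distinct entries as there are distances, because its entry
    is an injective function of the distance; its spectral projections are therefore the dual
    idempotents themselves.\<close>
  have "dual_idempotent hamming_adj x i \<in> ?Q" for i
    using indicator_diag_in_subalgebra[OF Q h, of "?N * (?D - of_nat i) - ?D"]
    by (simp add: dual_idempotent_diag)
  moreover have "adjacency_matrix hamming_adj \<in> ?Q"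
    unfolding adjacency_hamming[of x] using Q gens by (intro subalgebraD)
  ultimately show "subconstituent_algebra hamming_adj x \<subseteq> ?Q"
    unfolding subconstituent_algebra_def generated_subalgebra_def
    by (intro hull_minimal Q) auto
qed

end
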